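(* Let $E = C(\mathbb R)$ be the real Fréchet space of all continuous functions $\mathbb R\to\mathbb R$ with the topology of uniform convergence on bounded intervals. Let $\varphi:\mathbb R\to\mathbb R$ be real analytic, and suppose that the composition map $f_\varphi : E\to E$, $x\mapsto\varphi\circ x$, is real analytic in the sense of locally having holomorphic extensions between the complexifications (as defined in the context). Then there is a holomorphic function $\chi:\mathbb C\to\mathbb C$ with $\varphi = \chi|_{\mathbb R}$.
   Context: For complex Hausdorff locally convex spaces $G,H$ and an open set $W\subseteq G$, a map $g:W\to H$ is called holomorphic if it is $C^\infty$ over $\mathbb C$ in the following sense: $g$ is continuous and all iterated directional derivatives $d^{k}g(x;y_1,\dots,y_k)$ (limits of difference quotients with complex increments) exist for all $k\ge 1$, $x\in W$, $y_1,\dots,y_k\in G$, and define continuous maps $d^{k}g: W\times G^k\to H$. For a real Hausdorff locally convex space $E$, its complexification $E_{\rm cx}$ is the complex Hausdorff locally convex space with underlying set $E\times E$ (with the product topology, and $(x,y)$ thought of as $x+iy$); $E$ is identified with $E\times\{0\}\subseteq E_{\rm cx}$ via $x\mapsto (x,0)$. A map $f:U\to F$, with $U$ open in $E$ and $E,F$ real Hausdorff locally convex spaces, is called real analytic if locally it has a holomorphic extension: for every $x_0\in U$ there are an open neighbourhood $W$ of $(x_0,0)$ in $E_{\rm cx}$ and a holomorphic map $g:W\to F_{\rm cx}$ such that for all $x$ with $(x,0)\in W$ one has $x\in U$ and $g(x,0)=(f(x),0)$. *)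

theory Defs
  imports "HOL-Analysis.Analysis"
begin

section \<open>Hausdorff locally convex spaces\<close>

text \<open>
  The assumption \<open>locally_convex_explicit\<close> spells out \<open>convex_def\<close>, since the constant
  \<open>convex\<close> is not available in a class specification; see \<open>locally_convex\<close> below.
\<close>

class real_lcs = real_vector + topological_ab_group_add + t2_space +
  assumes tendsto_scaleR_Pair:
    "LIM x (nhds c \<times>\<^sub>F nhds a). fst x *\<^sub>R snd x :> nhds (c *\<^sub>R a)"
  and locally_convex_explicit:
    "open U \<Longrightarrow> 0 \<in> U \<Longrightarrow>
       \<exists>V. open V \<and> 0 \<in> V \<and>
         (\<forall>x\<in>V. \<forall>y\<in>V. \<forall>u\<ge>0. \<forall>v\<ge>0. u + v = 1 \<longrightarrow> u *\<^sub>R x + v *\<^sub>R y \<in> V) \<and> V \<subseteq> U"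

lemma locally_convex:
  fixes U :: "'a::real_lcs set"
  shows "open U \<Longrightarrow> 0 \<in> U \<Longrightarrow> \<exists>V. open V \<and> 0 \<in> V \<and> convex V \<and> V \<subseteq> U"
  unfolding convex_def by (rule locally_convex_explicit)

text \<open>A complex locally convex space is in particular a real one, by restriction of scalars.\<close>

class complex_lcs = real_lcs +
  fixes scaleC :: "complex \<Rightarrow> 'a \<Rightarrow> 'a" (infixr \<open>*\<^sub>C\<close> 75)
  assumes scaleC_add_right: "c *\<^sub>C (x + y) = c *\<^sub>C x + c *\<^sub>C y"
  and scaleC_add_left: "(c + d) *\<^sub>C x = c *\<^sub>C x + d *\<^sub>C x"
  and scaleC_scaleC: "c *\<^sub>C d *\<^sub>C x = (c * d) *\<^sub>C x"
  and scaleC_one: "1 *\<^sub>C x = x"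
  and scaleC_of_real: "complex_of_real r *\<^sub>C x = r *\<^sub>R x"
  and tendsto_scaleC_Pair:
    "LIM x (nhds c \<times>\<^sub>F nhds a). fst x *\<^sub>C snd x :> nhds (c *\<^sub>C a)"

instance real :: real_lcs
proof
  fix c a :: real
  show "LIM x (nhds c \<times>\<^sub>F nhds a). fst x *\<^sub>R snd x :> nhds (c *\<^sub>R a)"
    by (intro tendsto_scaleR filterlim_fst filterlim_snd)
next
  fix U :: "real set"
  assume "open U" "0 \<in> U"
  then obtain e where "e > 0" "ball 0 e \<subseteq> U"
    using openE by blast
  then show "\<exists>V. open V \<and> 0 \<in> V \<and>
         (\<forall>x\<in>V. \<forall>y\<in>V. \<forall>u\<ge>0. \<forall>v\<ge>0. u + v = 1 \<longrightarrow> u *\<^sub>R x + v *\<^sub>R y \<in> V) \<and> V \<subseteq> U"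
    unfolding convex_def[symmetric]
    by (intro exI[of _ "ball 0 e"]) auto
qed


section \<open>Holomorphic maps\<close>

text \<open>
  The value \<open>iter_dir_deriv k g x y\<close> is $d^k g(x; y_0, \ldots, y_{k-1})$, the iterated
  derivative of \<open>g\<close> at \<open>x\<close> in directions $y_0$, then $y_1$, and so on; it does not depend on
  \<open>y i\<close> for \<open>i \<ge> k\<close>. \<open>Lim\<close> is the actual limit only where that limit exists.
\<close>

definition diff_quot :: "('a::complex_lcs \<Rightarrow> 'b::complex_lcs) \<Rightarrow> 'a \<Rightarrow> 'a \<Rightarrow> complex \<Rightarrow> 'b"
  where "diff_quot g x v t = inverse t *\<^sub>C (g (x + t *\<^sub>C v) - g x)"

primrec iter_dir_deriv ::
  "nat \<Rightarrow> ('a::complex_lcs \<Rightarrow> 'b::complex_lcs) \<Rightarrow> 'a \<Rightarrow> (nat \<Rightarrow> 'a) \<Rightarrow> 'b" where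
  "iter_dir_deriv 0 g x y = g x"
| "iter_dir_deriv (Suc k) g x y =
     Lim (at 0) (diff_quot (\<lambda>z. iter_dir_deriv k g z y) x (y k))"

text \<open>
  In the existence clause, \<open>k\<close> is the order of the derivative being differentiated once more.
  The space of \<open>k\<close>-tuples of directions is the product of \<open>k\<close> copies of \<open>'a\<close> with the
  product topology.
\<close>

definition lcs_holomorphic_on ::
  "('a::complex_lcs \<Rightarrow> 'b::complex_lcs) \<Rightarrow> 'a set \<Rightarrow> bool" where
  "lcs_holomorphic_on g W \<longleftrightarrow>
     open W \<and> continuous_on W g \<and>
     (\<forall>k. \<forall>x\<in>W. \<forall>y. \<exists>l. (diff_quot (\<lambda>z. iter_dir_deriv k g z y) x (y k) \<longlongrightarrow> l) (at 0)) \<and>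
     (\<forall>k\<ge>1. continuous_map
        (prod_topology (top_of_set W) (product_topology (\<lambda>i. euclidean) {..<k})) euclidean
        (\<lambda>(x, y). iter_dir_deriv k g x y))"


section \<open>Complexification\<close>

datatype 'a cx = Cx (re_cx: 'a) (im_cx: 'a)

instantiation cx :: (real_vector) real_vector
begin

definition zero_cx where "0 = Cx 0 0"
definition plus_cx where "z + w = Cx (re_cx z + re_cx w) (im_cx z + im_cx w)"
definition minus_cx where "z - w = Cx (re_cx z - re_cx w) (im_cx z - im_cx w)"
definition uminus_cx where "- z = Cx (- re_cx z) (- im_cx z)"
definition scaleR_cx where "r *\<^sub>R z = Cx (r *\<^sub>R re_cx z) (r *\<^sub>R im_cx z)"

instance
  by standard
    (simp_all add: zero_cx_def plus_cx_def minus_cx_def uminus_cx_def scaleR_cx_def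
      algebra_simps)

end

instantiation cx :: (topological_space) topological_space
begin

definition open_cx :: "'a cx set \<Rightarrow> bool"
  where "open_cx U \<longleftrightarrow> open {(x, y). Cx x y \<in> U}"

instance
proof
  show "open (UNIV :: 'a cx set)"
    by (simp add: open_cx_def)
next
  fix S T :: "'a cx set"
  assume "open S" "open T"
  then have "open ({(x, y). Cx x y \<in> S} \<inter> {(x, y). Cx x y \<in> T})"
    by (auto simp: open_cx_def)
  also have "{(x, y). Cx x y \<in> S} \<inter> {(x, y). Cx x y \<in> T} = {(x, y). Cx x y \<in> S \<inter> T}"
    by auto
  finally show "open (S \<inter> T)"
    by (simp add: open_cx_def)
next
  fix K :: "'a cx set set"
  assume "\<forall>S\<in>K. open S"
  then have "open (\<Union>S\<in>K. {(x, y). Cx x y \<in> S})"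
    by (auto simp: open_cx_def)
  also have "(\<Union>S\<in>K. {(x, y). Cx x y \<in> S}) = {(x, y). Cx x y \<in> \<Union>K}"
    by auto
  finally show "open (\<Union>K)"
    by (simp add: open_cx_def)
qed

end

lemma tendsto_cx_iff:
  fixes l :: "'a::topological_space cx"
  shows
  "(f \<longlongrightarrow> l) F \<longleftrightarrow>
     ((\<lambda>i. re_cx (f i)) \<longlongrightarrow> re_cx l) F \<and> ((\<lambda>i. im_cx (f i)) \<longlongrightarrow> im_cx l) F"
proof -
  have "(f \<longlongrightarrow> l) F \<longleftrightarrow> ((\<lambda>i. (re_cx (f i), im_cx (f i))) \<longlongrightarrow> (re_cx l, im_cx l)) F"
    (is "?L \<longleftrightarrow> ?R")
  proof
    assume L: ?L
    show ?R
    proof (rule topological_tendstoI)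
      fix S :: "('a \<times> 'a) set"
      assume S: "open S" "(re_cx l, im_cx l) \<in> S"
      have "open {z. (re_cx z, im_cx z) \<in> S}"
        using S(1) by (simp add: open_cx_def)
      with L S(2) show "\<forall>\<^sub>F i in F. (re_cx (f i), im_cx (f i)) \<in> S"
        using topological_tendstoD by fastforce
    qed
  next
    assume R: ?R
    show ?L
    proof (rule topological_tendstoI)
      fix S :: "'a cx set"
      assume "open S" "l \<in> S"
      with topological_tendstoD[OF R, of "{(x, y). Cx x y \<in> S}"]
      show "\<forall>\<^sub>F i in F. f i \<in> S"
        by (simp add: open_cx_def)
    qed
  qed
  also have "\<dots> \<longleftrightarrow> ((\<lambda>i. re_cx (f i)) \<longlongrightarrow> re_cx l) F \<and> ((\<lambda>i. im_cx (f i)) \<longlongrightarrow> im_cx l) F"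
    by (auto intro: tendsto_Pair dest: tendsto_fst tendsto_snd)
  finally show ?thesis .
qed

lemma
  fixes l :: "'a::topological_space cx"
  shows tendsto_re_cx: "(f \<longlongrightarrow> l) F \<Longrightarrow> ((\<lambda>i. re_cx (f i)) \<longlongrightarrow> re_cx l) F"
  and tendsto_im_cx: "(f \<longlongrightarrow> l) F \<Longrightarrow> ((\<lambda>i. im_cx (f i)) \<longlongrightarrow> im_cx l) F"
  by (simp_all add: tendsto_cx_iff)

lemma open_cx_Times:
  assumes "open A" "open B"
  shows "open {z. re_cx z \<in> A \<and> im_cx z \<in> B}"
proof -
  have "open (A \<times> B)"
    using assms by (rule open_Times)
  also have "A \<times> B = {(x, y). x \<in> A \<and> y \<in> B}"
    by auto
  finally show ?thesis
    by (simp add: open_cx_def)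
qed

lemma tendsto_scaleR_lcs:
  fixes g :: "'b \<Rightarrow> 'a::real_lcs"
  assumes "(f \<longlongrightarrow> c) F" "(g \<longlongrightarrow> a) F"
  shows "((\<lambda>i. f i *\<^sub>R g i) \<longlongrightarrow> c *\<^sub>R a) F"
  using filterlim_compose[OF tendsto_scaleR_Pair, of "\<lambda>i. (f i, g i)" c a F] assms
  by (simp add: nhds_prod[symmetric] tendsto_Pair)

instance cx :: (real_lcs) real_lcs
proof
  fix a b :: "'a cx"
  show "LIM x (nhds a \<times>\<^sub>F nhds b). fst x + snd x :> nhds (a + b)"
    unfolding tendsto_cx_iff plus_cx_def cx.sel
    by (intro conjI tendsto_add tendsto_re_cx tendsto_im_cx filterlim_fst filterlim_snd)
next
  fix a :: "'a cx"
  show "(uminus \<longlongrightarrow> - a) (nhds a)"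
    unfolding tendsto_cx_iff uminus_cx_def cx.sel
    by (intro conjI tendsto_minus tendsto_re_cx tendsto_im_cx filterlim_ident)
next
  fix z w :: "'a cx"
  assume "z \<noteq> w"
  then have "(re_cx z, im_cx z) \<noteq> (re_cx w, im_cx w)"
    by (metis cx.expand prod.inject)
  then obtain U V where UV: "open U" "open V" "(re_cx z, im_cx z) \<in> U"
    "(re_cx w, im_cx w) \<in> V" "U \<inter> V = {}"
    using hausdorff[of "(re_cx z, im_cx z)" "(re_cx w, im_cx w)"] by metis
  show "\<exists>U V. open U \<and> open V \<and> z \<in> U \<and> w \<in> V \<and> U \<inter> V = {}"
    using UV
    by (intro exI[of _ "{z. (re_cx z, im_cx z) \<in> U}"] exI[of _ "{z. (re_cx z, im_cx z) \<in> V}"])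
      (auto simp: open_cx_def)
next
  fix c :: real and a :: "'a cx"
  show "LIM x (nhds c \<times>\<^sub>F nhds a). fst x *\<^sub>R snd x :> nhds (c *\<^sub>R a)"
    unfolding tendsto_cx_iff scaleR_cx_def cx.sel
    by (intro conjI tendsto_scaleR_lcs tendsto_re_cx tendsto_im_cx filterlim_fst filterlim_snd)
next
  fix U :: "'a cx set"
  assume "open U" "0 \<in> U"
  then have "open {(x, y). Cx x y \<in> U}" "(0, 0) \<in> {(x, y). Cx x y \<in> U}"
    by (simp_all add: open_cx_def zero_cx_def)
  then obtain A B where AB: "open A" "open B" "(0, 0) \<in> A \<times> B"
    "A \<times> B \<subseteq> {(x, y). Cx x y \<in> U}"
    by (rule open_prod_elim)
  obtain A' where A': "open A'" "0 \<in> A'" "convex A'" "A' \<subseteq> A"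
    using locally_convex[of A] AB by auto
  obtain B' where B': "open B'" "0 \<in> B'" "convex B'" "B' \<subseteq> B"
    using locally_convex[of B] AB by auto
  have "convex {z. re_cx z \<in> A' \<and> im_cx z \<in> B'}"
  proof (rule convexI)
    fix z w and u v :: real
    assume "z \<in> {z. re_cx z \<in> A' \<and> im_cx z \<in> B'}" "w \<in> {z. re_cx z \<in> A' \<and> im_cx z \<in> B'}"
      and "0 \<le> u" "0 \<le> v" "u + v = 1"
    then show "u *\<^sub>R z + v *\<^sub>R w \<in> {z. re_cx z \<in> A' \<and> im_cx z \<in> B'}"
      using convexD[OF A'(3), of "re_cx z" "re_cx w" u v]
        convexD[OF B'(3), of "im_cx z" "im_cx w" u v]
      by (simp add: plus_cx_def scaleR_cx_def)
  qed
  moreover have "{z. re_cx z \<in> A' \<and> im_cx z \<in> B'} \<subseteq> U"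
  proof
    fix z
    assume "z \<in> {z. re_cx z \<in> A' \<and> im_cx z \<in> B'}"
    then have "(re_cx z, im_cx z) \<in> A \<times> B"
      using A' B' by auto
    with AB(4) show "z \<in> U"
      by auto
  qed
  ultimately show "\<exists>V. open V \<and> 0 \<in> V \<and>
         (\<forall>x\<in>V. \<forall>y\<in>V. \<forall>u\<ge>0. \<forall>v\<ge>0. u + v = 1 \<longrightarrow> u *\<^sub>R x + v *\<^sub>R y \<in> V) \<and> V \<subseteq> U"
    unfolding convex_def[symmetric]
    using A' B' by (intro exI[of _ "{z. re_cx z \<in> A' \<and> im_cx z \<in> B'}"])
      (auto simp: open_cx_Times zero_cx_def)
qed

instantiation cx :: (real_lcs) complex_lcs
begin

definition scaleC_cx where
  "c *\<^sub>C z = Cx (Re c *\<^sub>R re_cx z - Im c *\<^sub>R im_cx z) (Re c *\<^sub>R im_cx z + Im c *\<^sub>R re_cx z)"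

instance
proof
  fix c :: complex and a :: "'a cx"
  have R: "((\<lambda>x. Re (fst x)) \<longlongrightarrow> Re c) (nhds c \<times>\<^sub>F nhds a)"
    and I: "((\<lambda>x. Im (fst x)) \<longlongrightarrow> Im c) (nhds c \<times>\<^sub>F nhds a)"
    by (intro tendsto_Re tendsto_Im filterlim_fst)+
  show "LIM x (nhds c \<times>\<^sub>F nhds a). fst x *\<^sub>C snd x :> nhds (c *\<^sub>C a)"
    unfolding tendsto_cx_iff scaleC_cx_def cx.sel
    by (intro conjI tendsto_add tendsto_diff tendsto_scaleR_lcs R I
          tendsto_re_cx tendsto_im_cx filterlim_snd)
qed (simp_all add: scaleC_cx_def plus_cx_def scaleR_cx_def algebra_simps)

end


section \<open>Real analytic maps\<close>

definition real_analytic_on :: "'a::real_lcs set \<Rightarrow> ('a \<Rightarrow> 'b::real_lcs) \<Rightarrow> bool" where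
  "real_analytic_on U f \<longleftrightarrow>
     open U \<and>
     (\<forall>x0\<in>U. \<exists>W g. open W \<and> Cx x0 0 \<in> W \<and> lcs_holomorphic_on g W \<and>
        (\<forall>x. Cx x 0 \<in> W \<longrightarrow> x \<in> U \<and> g (Cx x 0) = Cx (f x) 0))"

lemma real_analytic_on_imp_continuous_on:
  assumes "real_analytic_on U f"
  shows "continuous_on U f"
  unfolding continuous_on_def
proof
  fix x0
  assume "x0 \<in> U"
  then obtain W g where W: "open W" "Cx x0 0 \<in> W" "lcs_holomorphic_on g W"
    "\<And>x. Cx x 0 \<in> W \<Longrightarrow> g (Cx x 0) = Cx (f x) 0"
    using assms unfolding real_analytic_on_def by blast
  have "isCont g (Cx x0 0)"
    using W(1-3) continuous_on_eq_continuous_at unfolding lcs_holomorphic_on_def by blast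
  have *: "((\<lambda>x. Cx x 0) \<longlongrightarrow> Cx x0 0) (at x0 within U)"
    unfolding tendsto_cx_iff by simp
  have "((\<lambda>x. g (Cx x 0)) \<longlongrightarrow> Cx (f x0) 0) (at x0 within U)"
    using isCont_tendsto_compose[OF \<open>isCont g (Cx x0 0)\<close> *] W(2,4) by simp
  then have "((\<lambda>x. re_cx (g (Cx x 0))) \<longlongrightarrow> f x0) (at x0 within U)"
    unfolding tendsto_cx_iff by simp
  moreover have "\<forall>\<^sub>F x in at x0 within U. re_cx (g (Cx x 0)) = f x"
    using topological_tendstoD[OF * W(1,2)] by eventually_elim (simp add: W)
  ultimately show "(f \<longlongrightarrow> f x0) (at x0 within U)"
    by (rule Lim_transform_eventually)
qed


section \<open>The space of continuous functions on the real line\<close>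

typedef cont_fun = "{f :: real \<Rightarrow> real. continuous_on UNIV f}"
  morphisms apply_cont_fun Abs_cont_fun
  by (rule exI[of _ "\<lambda>_. 0"]) simp

setup_lifting type_definition_cont_fun

instantiation cont_fun :: real_vector
begin

lift_definition zero_cont_fun :: cont_fun is "\<lambda>_. 0" by simp
lift_definition plus_cont_fun :: "cont_fun \<Rightarrow> cont_fun \<Rightarrow> cont_fun"
  is "\<lambda>f g t. f t + g t" by (rule continuous_on_add)
lift_definition minus_cont_fun :: "cont_fun \<Rightarrow> cont_fun \<Rightarrow> cont_fun"
  is "\<lambda>f g t. f t - g t" by (rule continuous_on_diff)
lift_definition uminus_cont_fun :: "cont_fun \<Rightarrow> cont_fun"
  is "\<lambda>f t. - f t" by (rule continuous_on_minus)
lift_definition scaleR_cont_fun :: "real \<Rightarrow> cont_fun \<Rightarrow> cont_fun"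
  is "\<lambda>r f t. r *\<^sub>R f t" by (intro continuous_intros)

instance
  by standard (transfer; simp add: fun_eq_iff algebra_simps)+

end

text \<open>
  Every bounded interval lies in some \<open>{-r..r}\<close>, so these suffice to generate the topology;
  see \<open>tendsto_cont_fun_iff\<close> below.
\<close>

definition cf_ball :: "cont_fun \<Rightarrow> real \<Rightarrow> real \<Rightarrow> cont_fun set"
  where "cf_ball x r e = {y. \<forall>t\<in>{-r..r}. \<bar>apply_cont_fun y t - apply_cont_fun x t\<bar> < e}"

lemma cf_ball_mono: "r' \<le> r \<Longrightarrow> e \<le> e' \<Longrightarrow> cf_ball x r e \<subseteq> cf_ball x r' e'"
  unfolding cf_ball_def by (smt (verit) Collect_mono atLeastAtMost_iff)

instantiation cont_fun :: topological_space
begin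

definition open_cont_fun :: "cont_fun set \<Rightarrow> bool"
  where "open_cont_fun U \<longleftrightarrow> (\<forall>x\<in>U. \<exists>r. \<exists>e>0. cf_ball x r e \<subseteq> U)"

instance
proof
  show "open (UNIV :: cont_fun set)"
    by (auto simp: open_cont_fun_def intro: zero_less_one)
next
  fix S T :: "cont_fun set"
  assume ST: "open S" "open T"
  show "open (S \<inter> T)"
    unfolding open_cont_fun_def
  proof
    fix x
    assume "x \<in> S \<inter> T"
    then obtain r e r' e' where
      *: "e > 0" "cf_ball x r e \<subseteq> S" "e' > 0" "cf_ball x r' e' \<subseteq> T"
      using ST unfolding open_cont_fun_def by (metis IntE)
    have "cf_ball x (max r r') (min e e') \<subseteq> S \<inter> T"
      using * cf_ball_mono[of r "max r r'" "min e e'" e x]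
        cf_ball_mono[of r' "max r r'" "min e e'" e' x] by auto
    then show "\<exists>r. \<exists>e>0. cf_ball x r e \<subseteq> S \<inter> T"
      using * by (metis min_less_iff_conj)
  qed
next
  fix K :: "cont_fun set set"
  assume "\<forall>S\<in>K. open S"
  then show "open (\<Union>K)"
    unfolding open_cont_fun_def by (meson Union_iff Union_upper order_trans)
qed

end

lemma open_cf_ball: "open (cf_ball x r e)"
  unfolding open_cont_fun_def
proof
  fix y
  assume y: "y \<in> cf_ball x r e"
  show "\<exists>r'. \<exists>e'>0. cf_ball y r' e' \<subseteq> cf_ball x r e"
  proof (cases "r \<ge> 0")
    case False
    then show ?thesis
      by (intro exI[of _ r] exI[of _ 1]) (auto simp: cf_ball_def)
  next
    case True
    have "continuous_on {-r..r} (apply_cont_fun z)" for z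
      using apply_cont_fun[of z] continuous_on_subset by blast
    then have "continuous_on {-r..r} (\<lambda>t. \<bar>apply_cont_fun y t - apply_cont_fun x t\<bar>)"
      by (intro continuous_intros)
    then obtain s where s: "s \<in> {-r..r}"
      "\<And>t. t \<in> {-r..r} \<Longrightarrow> \<bar>apply_cont_fun y t - apply_cont_fun x t\<bar>
                              \<le> \<bar>apply_cont_fun y s - apply_cont_fun x s\<bar>"
      using continuous_attains_sup[of "{-r..r}"] True by force
    define d where "d = e - \<bar>apply_cont_fun y s - apply_cont_fun x s\<bar>"
    have "d > 0"
      using y s(1) by (auto simp: cf_ball_def d_def)
    moreover have "cf_ball y r d \<subseteq> cf_ball x r e"
    proof
      fix z
      assume z: "z \<in> cf_ball y r d"
      have "\<bar>apply_cont_fun z t - apply_cont_fun x t\<bar> < e" if "t \<in> {-r..r}" for t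
      proof -
        have "\<bar>apply_cont_fun z t - apply_cont_fun y t\<bar> < d"
          using z that by (simp add: cf_ball_def)
        with s(2)[OF that] show ?thesis
          unfolding d_def by linarith
      qed
      then show "z \<in> cf_ball x r e"
        by (simp add: cf_ball_def)
    qed
    ultimately show ?thesis
      by blast
  qed
qed

lemma tendsto_cont_fun_iff':
  "(f \<longlongrightarrow> x) F \<longleftrightarrow>
     (\<forall>r. uniform_limit {-r..r} (\<lambda>i. apply_cont_fun (f i)) (apply_cont_fun x) F)"
proof safe
  fix r
  assume lim: "(f \<longlongrightarrow> x) F"
  show "uniform_limit {-r..r} (\<lambda>i. apply_cont_fun (f i)) (apply_cont_fun x) F"
  proof (rule uniform_limitI)
    fix e :: real
    assume "e > 0"
    then have "x \<in> cf_ball x r e"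
      by (simp add: cf_ball_def)
    then have "\<forall>\<^sub>F i in F. f i \<in> cf_ball x r e"
      using lim open_cf_ball topological_tendstoD by blast
    then show "\<forall>\<^sub>F i in F. \<forall>t\<in>{-r..r}. dist (apply_cont_fun (f i) t) (apply_cont_fun x t) < e"
      by eventually_elim (simp add: cf_ball_def dist_real_def)
  qed
next
  assume lim: "\<forall>r. uniform_limit {-r..r} (\<lambda>i. apply_cont_fun (f i)) (apply_cont_fun x) F"
  show "(f \<longlongrightarrow> x) F"
  proof (rule topological_tendstoI)
    fix S
    assume "open S" "x \<in> S"
    then obtain r e where re: "e > 0" "cf_ball x r e \<subseteq> S"
      unfolding open_cont_fun_def by blast
    have "\<forall>\<^sub>F i in F. \<forall>t\<in>{-r..r}. dist (apply_cont_fun (f i) t) (apply_cont_fun x t) < e"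
      using lim re(1) uniform_limitD by blast
    then show "\<forall>\<^sub>F i in F. f i \<in> S"
      by eventually_elim (use re(2) in \<open>auto simp: cf_ball_def dist_real_def\<close>)
  qed
qed

lemma tendsto_cont_fun_iff:
  "(f \<longlongrightarrow> x) F \<longleftrightarrow>
     (\<forall>S. bounded S \<longrightarrow> uniform_limit S (\<lambda>i. apply_cont_fun (f i)) (apply_cont_fun x) F)"
proof -
  have "\<exists>r. S \<subseteq> {-r..r}" if "bounded S" for S :: "real set"
    using that unfolding bounded_iff by (metis abs_le_iff atLeastAtMost_iff minus_le_iff
        real_norm_def subsetI)
  moreover have "bounded {-r..r}" for r :: real
    by simp
  ultimately show ?thesis
    unfolding tendsto_cont_fun_iff' by (meson uniform_limit_on_subset)
qed

instance cont_fun :: real_lcs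
proof
  fix a b :: cont_fun
  have "((\<lambda>x. fst x) \<longlongrightarrow> a) (nhds a \<times>\<^sub>F nhds b)" "((\<lambda>x. snd x) \<longlongrightarrow> b) (nhds a \<times>\<^sub>F nhds b)"
    by (rule filterlim_fst filterlim_snd)+
  then show "LIM x (nhds a \<times>\<^sub>F nhds b). fst x + snd x :> nhds (a + b)"
    unfolding tendsto_cont_fun_iff' plus_cont_fun.rep_eq
    by (intro allI uniform_limit_add) blast+
next
  fix a :: cont_fun
  have "((\<lambda>x. x) \<longlongrightarrow> a) (nhds a)"
    by (rule filterlim_ident)
  then show "(uminus \<longlongrightarrow> - a) (nhds a)"
    unfolding tendsto_cont_fun_iff' uminus_cont_fun.rep_eq
    by (intro allI uniform_limit_uminus) blast
next
  fix x y :: cont_fun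
  assume "x \<noteq> y"
  then obtain t where t: "apply_cont_fun x t \<noteq> apply_cont_fun y t"
    by (metis apply_cont_fun_inject ext)
  define e where "e = \<bar>apply_cont_fun x t - apply_cont_fun y t\<bar> / 2"
  have "e > 0"
    using t by (simp add: e_def)
  moreover have "cf_ball x \<bar>t\<bar> e \<inter> cf_ball y \<bar>t\<bar> e = {}"
  proof -
    have False if "z \<in> cf_ball x \<bar>t\<bar> e" "z \<in> cf_ball y \<bar>t\<bar> e" for z
    proof -
      have "t \<in> {-\<bar>t\<bar>..\<bar>t\<bar>}"
        by auto
      then have "\<bar>apply_cont_fun z t - apply_cont_fun x t\<bar> < e"
        "\<bar>apply_cont_fun z t - apply_cont_fun y t\<bar> < e"
        using that unfolding cf_ball_def by blast+
      moreover have "\<bar>apply_cont_fun x t - apply_cont_fun y t\<bar>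
          \<le> \<bar>apply_cont_fun z t - apply_cont_fun x t\<bar> + \<bar>apply_cont_fun z t - apply_cont_fun y t\<bar>"
        by linarith
      ultimately show False
        unfolding e_def by argo
    qed
    then show ?thesis
      by blast
  qed
  ultimately show "\<exists>U V. open U \<and> open V \<and> x \<in> U \<and> y \<in> V \<and> U \<inter> V = {}"
    by (intro exI[of _ "cf_ball x \<bar>t\<bar> e"] exI[of _ "cf_ball y \<bar>t\<bar> e"])
      (simp add: open_cf_ball, simp add: cf_ball_def)
next
  fix c :: real and a :: cont_fun
  have "bounded (apply_cont_fun a ` {-r..r})" for r
    using apply_cont_fun[of a]
    by (auto intro!: compact_imp_bounded compact_continuous_image intro: continuous_on_subset)
  moreover have "uniform_limit {-r..r} (\<lambda>x _. fst x) (\<lambda>_. c) (nhds c \<times>\<^sub>F nhds a)" for r :: real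
  proof (rule uniform_limitI)
    fix e :: real
    assume "e > 0"
    have "((\<lambda>x. fst x) \<longlongrightarrow> c) (nhds c \<times>\<^sub>F nhds a)"
      by (rule filterlim_fst)
    from tendstoD[OF this \<open>e > 0\<close>]
    show "\<forall>\<^sub>F n in nhds c \<times>\<^sub>F nhds a. \<forall>x\<in>{-r..r}. dist (fst n) c < e"
      by eventually_elim simp
  qed
  moreover have "((\<lambda>x. snd x) \<longlongrightarrow> a) (nhds c \<times>\<^sub>F nhds a)"
    by (rule filterlim_snd)
  moreover have "bounded ((\<lambda>_. c) ` {-r..r})" for r :: real
    by (rule finite_imp_bounded, rule finite_subset[of _ "{c}"]) auto
  ultimately show "LIM x (nhds c \<times>\<^sub>F nhds a). fst x *\<^sub>R snd x :> nhds (c *\<^sub>R a)"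
    unfolding tendsto_cont_fun_iff' scaleR_cont_fun.rep_eq
    by (intro allI bounded_bilinear.bounded_uniform_limit[OF bounded_bilinear_scaleR]) blast+
next
  fix U :: "cont_fun set"
  assume "open U" "0 \<in> U"
  then obtain r e where re: "e > 0" "cf_ball 0 r e \<subseteq> U"
    unfolding open_cont_fun_def by blast
  have "convex (cf_ball 0 r e)"
  proof (rule convexI)
    fix x y and u v :: real
    assume *: "x \<in> cf_ball 0 r e" "y \<in> cf_ball 0 r e" "0 \<le> u" "0 \<le> v" "u + v = 1"
    have "\<bar>u * apply_cont_fun x t + v * apply_cont_fun y t\<bar> < e" if "t \<in> {-r..r}" for t
    proof -
      have "apply_cont_fun x t \<in> ball 0 e" "apply_cont_fun y t \<in> ball 0 e"
        using * that by (auto simp: cf_ball_def zero_cont_fun.rep_eq)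
      then have "u *\<^sub>R apply_cont_fun x t + v *\<^sub>R apply_cont_fun y t \<in> ball 0 e"
        using * by (intro convexD[OF convex_ball])
      then show ?thesis
        by simp
    qed
    then show "u *\<^sub>R x + v *\<^sub>R y \<in> cf_ball 0 r e"
      by (simp add: cf_ball_def zero_cont_fun.rep_eq plus_cont_fun.rep_eq scaleR_cont_fun.rep_eq)
  qed
  then show "\<exists>V. open V \<and> 0 \<in> V \<and>
         (\<forall>x\<in>V. \<forall>y\<in>V. \<forall>u\<ge>0. \<forall>v\<ge>0. u + v = 1 \<longrightarrow> u *\<^sub>R x + v *\<^sub>R y \<in> V) \<and> V \<subseteq> U"
    unfolding convex_def[symmetric]
    using re by (intro exI[of _ "cf_ball 0 r e"]) (simp add: open_cf_ball, simp add: cf_ball_def)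
qed

text \<open>Meaningful for continuous \<open>\<phi>\<close> only.\<close>

definition comp_map :: "(real \<Rightarrow> real) \<Rightarrow> cont_fun \<Rightarrow> cont_fun"
  where "comp_map \<phi> x = Abs_cont_fun (\<phi> \<circ> apply_cont_fun x)"

lemma apply_comp_map:
  assumes "continuous_on UNIV \<phi>"
  shows "apply_cont_fun (comp_map \<phi> x) = \<phi> \<circ> apply_cont_fun x"
  unfolding comp_map_def
  using assms apply_cont_fun[of x]
  by (intro Abs_cont_fun_inverse)
    (auto simp del: o_apply intro!: continuous_on_compose intro: continuous_on_subset)

end

theory Submission
  imports Defs
begin

text \<open>
  The topology of \<open>C(\<real>)\<close> only controls functions on a bounded interval, so its nonempty open sets
  contain whole lines. Let \<open>g\<close> be a holomorphic extension of \<open>x \<mapsto> \<phi> \<circ> x\<close> near \<open>0\<close>. Its domain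
  \<open>W\<close> contains all pairs of functions that are small on some \<open>{-r..r}\<close>, hence the whole complex
  line \<open>z \<mapsto> z b\<close> through any real function \<open>b\<close> that vanishes on \<open>{-r..r}\<close>
  (\<open>open_cx_cont_fun_contains_line\<close>).
  Choose \<open>b\<close> with \<open>b s = 1\<close> at a point \<open>s\<close> outside the interval. Then \<open>z \<mapsto> g (z b)\<close>, evaluated at \<open>s\<close>,
  is an entire function, because evaluation is a continuous complex linear functional
  (\<open>holomorphic_on_functional_line\<close>); for real \<open>z\<close> it takes the value \<open>\<phi> (z * b s) = \<phi> z\<close>.
\<close>

text \<open>
  Being linear and continuous, the functional carries the difference quotients of \<open>g\<close> in
  direction \<open>v\<close>, and their limit, to those of a complex-valued function along the line.
\<close>

lemma holomorphic_on_functional_line: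
  fixes g :: "'a::complex_lcs \<Rightarrow> 'b::complex_lcs" and L :: "'b \<Rightarrow> complex"
  assumes g: "lcs_holomorphic_on g W"
    and line: "\<And>z. z \<in> A \<Longrightarrow> a + z *\<^sub>C v \<in> W"
    and diff: "\<And>x y. L (x - y) = L x - L y"
    and scale: "\<And>c x. L (c *\<^sub>C x) = c * L x"
    and cont: "continuous_on UNIV L"
  shows "(\<lambda>z. L (g (a + z *\<^sub>C v))) holomorphic_on A"
proof (rule holomorphic_onI)
  fix z assume "z \<in> A"
  have "\<exists>l. (diff_quot (\<lambda>w. iter_dir_deriv 0 g w (\<lambda>_. v)) (a + z *\<^sub>C v) v \<longlongrightarrow> l) (at 0)"
    using g line[OF \<open>z \<in> A\<close>] unfolding lcs_holomorphic_on_def by blast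
  then obtain l where "(diff_quot g (a + z *\<^sub>C v) v \<longlongrightarrow> l) (at 0)"
    by auto
  moreover have "isCont L l"
    using cont by (simp add: continuous_on_eq_continuous_at)
  ultimately have "((\<lambda>t. L (diff_quot g (a + z *\<^sub>C v) v t)) \<longlongrightarrow> L l) (at 0)"
    by (rule isCont_tendsto_compose[rotated])
  moreover have "L (diff_quot g (a + z *\<^sub>C v) v t) =
      (L (g (a + (z + t) *\<^sub>C v)) - L (g (a + z *\<^sub>C v))) / t" for t
    by (simp add: diff_quot_def scale diff scaleC_add_left add.assoc divide_inverse mult.commute)
  ultimately have "((\<lambda>z. L (g (a + z *\<^sub>C v))) has_field_derivative L l) (at z)"
    unfolding DERIV_def by simp
  then show "(\<lambda>z. L (g (a + z *\<^sub>C v))) field_differentiable (at z within A)"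
    unfolding field_differentiable_def using DERIV_subset by blast
qed

definition eval_cx :: "real \<Rightarrow> cont_fun cx \<Rightarrow> complex"
  where "eval_cx s z = Complex (apply_cont_fun (re_cx z) s) (apply_cont_fun (im_cx z) s)"

lemma eval_cx_diff: "eval_cx s (z - w) = eval_cx s z - eval_cx s w"
  by (simp add: eval_cx_def minus_cx_def minus_cont_fun.rep_eq complex_eq_iff)

lemma eval_cx_scaleC: "eval_cx s (c *\<^sub>C z) = c * eval_cx s z"
  by (simp add: eval_cx_def scaleC_cx_def minus_cont_fun.rep_eq plus_cont_fun.rep_eq
      scaleR_cont_fun.rep_eq complex_eq_iff)

lemma tendsto_apply_cont_fun:
  assumes "(f \<longlongrightarrow> x) F"
  shows "((\<lambda>i. apply_cont_fun (f i) s) \<longlongrightarrow> apply_cont_fun x s) F"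
proof -
  have "uniform_limit {-\<bar>s\<bar>..\<bar>s\<bar>} (\<lambda>i. apply_cont_fun (f i)) (apply_cont_fun x) F"
    using assms unfolding tendsto_cont_fun_iff' by blast
  then show ?thesis
    by (rule tendsto_uniform_limitI) auto
qed

lemma continuous_on_eval_cx: "continuous_on UNIV (eval_cx s)"
  unfolding continuous_on_def eval_cx_def
  by (intro ballI tendsto_Complex tendsto_apply_cont_fun tendsto_re_cx tendsto_im_cx tendsto_ident_at)

text \<open>
  Basic neighbourhoods of \<open>0\<close> test only the values on some \<open>{-r..r}\<close>, and there all multiples \<open>z b\<close>
  vanish, however large \<open>z\<close> is.
\<close>

lemma open_cx_cont_fun_contains_line:
  fixes W :: "cont_fun cx set"
  assumes "open W" "0 \<in> W"
  obtains r where
    "\<And>b z. (\<And>t. t \<in> {-r..r} \<Longrightarrow> apply_cont_fun b t = 0) \<Longrightarrow> z *\<^sub>C Cx b 0 \<in> W"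
proof -
  have "open {(x, y). Cx x y \<in> W}" "(0, 0) \<in> {(x, y). Cx x y \<in> W}"
    using assms by (simp_all add: open_cx_def zero_cx_def)
  then obtain A B where AB: "open A" "open B" "(0, 0) \<in> A \<times> B"
    "A \<times> B \<subseteq> {(x, y). Cx x y \<in> W}"
    by (rule open_prod_elim)
  then obtain r1 e1 r2 e2 where e: "e1 > 0" "cf_ball 0 r1 e1 \<subseteq> A" "e2 > 0" "cf_ball 0 r2 e2 \<subseteq> B"
    unfolding open_cont_fun_def by blast
  define r where "r = max r1 r2"
  have "z *\<^sub>C Cx b 0 \<in> W" if b: "\<And>t. t \<in> {-r..r} \<Longrightarrow> apply_cont_fun b t = 0" for b z
  proof -
    have "apply_cont_fun b t = 0" if "t \<in> {-r1..r1} \<union> {-r2..r2}" for t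
      using that by (intro b) (auto simp: r_def)
    then have "Re z *\<^sub>R b \<in> cf_ball 0 r1 e1" "Im z *\<^sub>R b \<in> cf_ball 0 r2 e2"
      using e by (auto simp: cf_ball_def scaleR_cont_fun.rep_eq zero_cont_fun.rep_eq)
    then have "Cx (Re z *\<^sub>R b) (Im z *\<^sub>R b) \<in> W"
      using e AB(4) by auto
    then show ?thesis
      by (simp add: scaleC_cx_def)
  qed
  then show thesis
    using that by blast
qed

theorem theorem2:
  fixes \<phi> :: "real \<Rightarrow> real"
  assumes "real_analytic_on UNIV \<phi>"
    and "real_analytic_on UNIV (comp_map \<phi>)"
  shows "\<exists>h :: complex \<Rightarrow> complex. h holomorphic_on UNIV \<and>
           (\<forall>x :: real. complex_of_real (\<phi> x) = h (complex_of_real x))"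
proof -
  have \<phi>: "continuous_on UNIV \<phi>"
    using assms(1) by (rule real_analytic_on_imp_continuous_on)
  obtain W g where W: "open W" "0 \<in> W" and g: "lcs_holomorphic_on g W"
    and ext: "\<And>x. Cx x 0 \<in> W \<Longrightarrow> g (Cx x 0) = Cx (comp_map \<phi> x) 0"
    using assms(2) unfolding real_analytic_on_def zero_cx_def by blast
  obtain r where r:
    "\<And>b z. (\<And>t. t \<in> {-r..r} \<Longrightarrow> apply_cont_fun b t = 0) \<Longrightarrow> z *\<^sub>C Cx b 0 \<in> W"
    using open_cx_cont_fun_contains_line[OF W] by blast
  define b where "b = Abs_cont_fun (\<lambda>t. max 0 (t - r))"
  have b: "apply_cont_fun b = (\<lambda>t. max 0 (t - r))"
    unfolding b_def by (rule Abs_cont_fun_inverse) (simp add: continuous_intros)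
  have line: "z *\<^sub>C Cx b 0 \<in> W" for z
    by (rule r) (simp add: b)
  define h where "h z = eval_cx (r + 1) (g (z *\<^sub>C Cx b 0))" for z
  have "h holomorphic_on UNIV"
    using holomorphic_on_functional_line[OF g, of UNIV 0 "Cx b 0", OF _ eval_cx_diff eval_cx_scaleC
        continuous_on_eval_cx] line
    unfolding h_def by simp
  moreover have "complex_of_real (\<phi> x) = h (complex_of_real x)" for x
  proof -
    have "complex_of_real x *\<^sub>C Cx b 0 = Cx (x *\<^sub>R b) 0"
      by (simp add: scaleC_cx_def)
    then have "h (complex_of_real x) = eval_cx (r + 1) (Cx (comp_map \<phi> (x *\<^sub>R b)) 0)"
      using ext line[of "complex_of_real x"] by (simp add: h_def)
    also have "\<dots> = complex_of_real (\<phi> x)"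
      by (simp add: eval_cx_def apply_comp_map[OF \<phi>] scaleR_cont_fun.rep_eq zero_cont_fun.rep_eq b
          complex_eq_iff)
    finally show ?thesis
      by simp
  qed
  ultimately show ?thesis
    by blast
qed

end
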